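(* Let $\mathbf{C},\mathbf{D}$ be chains, let $\mathbf{M}=\boxplus_{c\in C}\mathbf{M}_c$ and $\mathbf{N}=\boxplus_{d\in D}\mathbf{N}_d$ be idempotent ordered monoids with $\mathbf{M}_c,\mathbf{N}_d\in\{\mathbf{C}_2,\mathbf{C}_2^\partial,\mathbf{G}_3,\mathbf{D}_3\}$ for all $c\in C$, $d\in D$, let $\varphi\colon\mathbf{M}\to\mathbf{N}$ be an embedding, and let $f\colon\mathbf{C}\to\mathbf{D}$ be an order-embedding such that for every $c\in C$, $\mathbf{M}_c$ is a subalgebra of $\mathbf{N}_{f(c)}$. Let $f_\varphi\colon C\to D$ be the map sending $c$ to the unique $d\in D$ with $\varphi(M_c)\subseteq N_d$, and let $\varphi_f\colon M\to N$ be the map with $\varphi_f(a)=a\in N_{f(c)}$ for $a\in M_c$. Then: (1) The map $f_\varphi\colon C\to D$ is an order-embedding such that for every $c\in C$, $\mathbf{M}_c$ is a subalgebra of $\mathbf{N}_{f_\varphi(c)}$. (2) The map $\varphi_f\colon M\to N$ is an $\ell$-monoid embedding. (3) $\varphi_{f_\varphi}=\varphi$ and $f_{\varphi_f}=f$.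
   Context: An ordered monoid is a structure $\mathbf{M}=\langle M,\cdot,e,\le\rangle$ where $\langle M,\cdot,e\rangle$ is a monoid, $\le$ is a total order on $M$, and $a\le b$ implies $cad\le cbd$ for all $a,b,c,d\in M$; it is idempotent if $a\cdot a=a$ for all $a$. Ordered monoids are identified with the corresponding algebras $\langle M,\wedge,\vee,\cdot,e\rangle$; an ($\ell$-monoid) embedding between ordered monoids is an injective order-preserving monoid homomorphism (equivalently, an injective map preserving $\wedge,\vee,\cdot,e$). A chain is a totally ordered set. The four algebras are the following idempotent ordered monoids with identity $e$: $\mathbf{C}_2$ has universe $\{\bot<e\}$; $\mathbf{C}_2^\partial$ has universe $\{e<\top\}$; $\mathbf{G}_3$ has universe $\{\bot<e<\top\}$ with $\bot\cdot\top=\bot$, $\top\cdot\bot=\top$; $\mathbf{D}_3$ has universe $\{\bot<e<\top\}$ with $\bot\cdot\top=\top$, $\top\cdot\bot=\bot$. With this naming of elements, $\mathbf{C}_2$ and $\mathbf{C}_2^\partial$ are subalgebras of both $\mathbf{G}_3$ and $\mathbf{D}_3$ by inclusion. Nested sum: let $\mathbf{C}=\langle C,\sqsubseteq\rangle$ be a chain and $\{\mathbf{M}_c\}_{c\in C}$ a family of idempotent ordered monoids, relabeled so that $M_c\cap M_d=\{e\}$ for $c\ne d$. Then $\boxplus_{c\in C}\mathbf{M}_c=\langle\bigcup_{c\in C}M_c,\cdot,e,\le\rangle$, where $\cdot$ extends every $\cdot_c$ and $a\cdot b=b\cdot a=a$ whenever $c\sqsubset d$, $a\in M_c\setminus\{e\}$,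 $b\in M_d$; and $\le$ is the least extension of the orders $\le_c$ such that whenever $c\sqsubset d$, $a\in M_c\setminus\{e\}$, $b\in M_d$, we have $a\le b$ if $a\le_c e$, and $b\le a$ if $e\le_c a$. For $C=\emptyset$ it is the trivial ordered monoid. "$\mathbf{M}_c$ is a subalgebra of $\mathbf{N}_d$" refers to $\mathbf{M}_c,\mathbf{N}_d$ as members of $\{\mathbf{C}_2,\mathbf{C}_2^\partial,\mathbf{G}_3,\mathbf{D}_3\}$ (i.e. before relabeling), with the inclusions just described; accordingly $\varphi_f$ sends the element of the $c$-th summand of $\mathbf{M}$ named $\bot$, $\top$ or $e$ to the element of the same name in the $f(c)$-th summand of $\mathbf{N}$. For an embedding $\varphi$, the unique $d$ used to define $f_\varphi(c)$ always exists. *)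

theory Defs
  imports "HOL-Algebra.Group"
begin

section \<open>Idempotent ordered monoids\<close>

record 'a ordered_monoid = "'a monoid" +
  leq :: "'a \<Rightarrow> 'a \<Rightarrow> bool" (infix \<open>\<preceq>\<index>\<close> 50)

locale ordered_monoid = monoid M for M (structure) +
  assumes linear: "linear_order_on (carrier M) {(a, b). a \<in> carrier M \<and> b \<in> carrier M \<and> a \<preceq> b}"
    and leq_mult: "\<lbrakk>a \<in> carrier M; b \<in> carrier M; c \<in> carrier M; d \<in> carrier M; a \<preceq> b\<rbrakk>
      \<Longrightarrow> c \<otimes> a \<otimes> d \<preceq> c \<otimes> b \<otimes> d"

locale idempotent_ordered_monoid = ordered_monoid +
  assumes idem: "a \<in> carrier M \<Longrightarrow> a \<otimes> a = a"

text \<open>Since the orders are total, meets and joins need not be mentioned: an injective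
  order-preserving map preserves them, and any subset is closed under them.\<close>

definition lmonoid_embedding ::
    "('a, 'm) ordered_monoid_scheme \<Rightarrow> ('b, 'n) ordered_monoid_scheme \<Rightarrow> ('a \<Rightarrow> 'b) \<Rightarrow> bool" where
  "lmonoid_embedding M N \<phi> \<longleftrightarrow>
     \<phi> \<in> hom M N \<and> \<phi> \<one>\<^bsub>M\<^esub> = \<one>\<^bsub>N\<^esub> \<and> inj_on \<phi> (carrier M) \<and>
     (\<forall>a\<in>carrier M. \<forall>b\<in>carrier M. a \<preceq>\<^bsub>M\<^esub> b \<longrightarrow> \<phi> a \<preceq>\<^bsub>N\<^esub> \<phi> b)"

definition is_subalgebra_of ::
    "('a, 'm) ordered_monoid_scheme \<Rightarrow> ('a, 'n) ordered_monoid_scheme \<Rightarrow> bool" where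
  "is_subalgebra_of M N \<longleftrightarrow>
     submonoid (carrier M) N \<and> \<one>\<^bsub>M\<^esub> = \<one>\<^bsub>N\<^esub> \<and>
     (\<forall>a\<in>carrier M. \<forall>b\<in>carrier M.
        a \<otimes>\<^bsub>M\<^esub> b = a \<otimes>\<^bsub>N\<^esub> b \<and> (a \<preceq>\<^bsub>M\<^esub> b \<longleftrightarrow> a \<preceq>\<^bsub>N\<^esub> b))"

definition order_embedding :: "'c set \<Rightarrow> 'c rel \<Rightarrow> 'd set \<Rightarrow> 'd rel \<Rightarrow> ('c \<Rightarrow> 'd) \<Rightarrow> bool" where
  "order_embedding C r D s f \<longleftrightarrow>
     f ` C \<subseteq> D \<and> (\<forall>c\<in>C. \<forall>c'\<in>C. (c, c') \<in> r \<longleftrightarrow> (f c, f c') \<in> s)"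

section \<open>The four algebras\<close>

datatype elt = Bot | Unit | Top

definition G3 :: "elt ordered_monoid" where
  "G3 = \<lparr>carrier = {Bot, Unit, Top}, mult = (\<lambda>a b. if a = Unit then b else a), one = Unit,
         leq = (\<lambda>a b. a = b \<or> a = Bot \<or> b = Top)\<rparr>"

definition D3 :: "elt ordered_monoid" where
  "D3 = \<lparr>carrier = {Bot, Unit, Top}, mult = (\<lambda>a b. if b = Unit then a else b), one = Unit,
         leq = (\<lambda>a b. a = b \<or> a = Bot \<or> b = Top)\<rparr>"

text \<open>On a two-element universe the product is determined by the unit and idempotence, so taking
  it from \<open>G3\<close> or from \<open>D3\<close> makes no difference on the carrier.\<close>

definition C2 :: "elt ordered_monoid" where
  "C2 = G3\<lparr>carrier := {Bot, Unit}\<rparr>"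

definition C2_dual :: "elt ordered_monoid" where
  "C2_dual = G3\<lparr>carrier := {Unit, Top}\<rparr>"

lemma idempotent_ordered_monoid_four:
  assumes "A \<in> {C2, C2_dual, G3, D3}"
  shows "idempotent_ordered_monoid A"
  using assms
  by (elim insertE emptyE; hypsubst; unfold_locales)
    (auto simp: G3_def D3_def C2_def C2_dual_def order_on_defs refl_on_def total_on_def
      intro!: transI antisymI)

section \<open>Nested sums\<close>

text \<open>The relabeling that makes the summands meet in the unit only is the following: \<open>None\<close> is
  the common unit, and \<open>Some (c, a)\<close> is the non-unit element \<open>a\<close> of the \<open>c\<close>-th summand.\<close>

definition inj_summand ::
    "('c \<Rightarrow> ('a, 'm) ordered_monoid_scheme) \<Rightarrow> 'c \<Rightarrow> 'a \<Rightarrow> ('c \<times> 'a) option" where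
  "inj_summand M c a = (if a = \<one>\<^bsub>M c\<^esub> then None else Some (c, a))"

definition summand ::
    "('c \<Rightarrow> ('a, 'm) ordered_monoid_scheme) \<Rightarrow> 'c \<Rightarrow> ('c \<times> 'a) option set" where
  "summand M c = inj_summand M c ` carrier (M c)"

fun nested_mult ::
    "'c rel \<Rightarrow> ('c \<Rightarrow> ('a, 'm) ordered_monoid_scheme) \<Rightarrow>
     ('c \<times> 'a) option \<Rightarrow> ('c \<times> 'a) option \<Rightarrow> ('c \<times> 'a) option" where
  "nested_mult r M None y = y"
| "nested_mult r M (Some p) None = Some p"
| "nested_mult r M (Some (c, a)) (Some (d, b)) =
     (if c = d then inj_summand M c (a \<otimes>\<^bsub>M c\<^esub> b)
      else if (c, d) \<in> r then Some (c, a) else Some (d, b))"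

text \<open>The least relation closed under the rules below. The rule \<open>unit\<close> only matters for the empty
  sum; otherwise it is an instance of \<open>same\<close>.\<close>

inductive nested_leq ::
    "'c set \<Rightarrow> 'c rel \<Rightarrow> ('c \<Rightarrow> ('a, 'm) ordered_monoid_scheme) \<Rightarrow>
     ('c \<times> 'a) option \<Rightarrow> ('c \<times> 'a) option \<Rightarrow> bool"
  for C r M where
  unit: "nested_leq C r M None None"
| same: "\<lbrakk>c \<in> C; a \<in> carrier (M c); b \<in> carrier (M c); a \<preceq>\<^bsub>M c\<^esub> b\<rbrakk>
    \<Longrightarrow> nested_leq C r M (inj_summand M c a) (inj_summand M c b)"
| below: "\<lbrakk>c \<in> C; d \<in> C; (c, d) \<in> r; c \<noteq> d; a \<in> carrier (M c) - {\<one>\<^bsub>M c\<^esub>}; b \<in> carrier (M d);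
     a \<preceq>\<^bsub>M c\<^esub> \<one>\<^bsub>M c\<^esub>\<rbrakk>
    \<Longrightarrow> nested_leq C r M (inj_summand M c a) (inj_summand M d b)"
| above: "\<lbrakk>c \<in> C; d \<in> C; (c, d) \<in> r; c \<noteq> d; a \<in> carrier (M c) - {\<one>\<^bsub>M c\<^esub>}; b \<in> carrier (M d);
     \<one>\<^bsub>M c\<^esub> \<preceq>\<^bsub>M c\<^esub> a\<rbrakk>
    \<Longrightarrow> nested_leq C r M (inj_summand M d b) (inj_summand M c a)"

definition nested_sum ::
    "'c set \<Rightarrow> 'c rel \<Rightarrow> ('c \<Rightarrow> ('a, 'm) ordered_monoid_scheme) \<Rightarrow>
     ('c \<times> 'a) option ordered_monoid" where
  "nested_sum C r M =
     \<lparr>carrier = {None} \<union> (\<Union>c\<in>C. summand M c), mult = nested_mult r M, one = None,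
      leq = nested_leq C r M\<rparr>"

section \<open>Translating between embeddings of sums and embeddings of chains\<close>

text \<open>\<open>index_map\<close> is the map \<open>f\<^sub>\<phi>\<close>; its value is unspecified where no unique \<open>d\<close> exists, which
  cannot happen for an embedding. \<open>sum_map\<close> is the map \<open>\<phi>\<^sub>f\<close>, which keeps the name of an element
  and changes only its summand.\<close>

definition index_map ::
    "('c \<Rightarrow> ('a, 'm) ordered_monoid_scheme) \<Rightarrow> 'd set \<Rightarrow> ('d \<Rightarrow> ('b, 'n) ordered_monoid_scheme) \<Rightarrow>
     (('c \<times> 'a) option \<Rightarrow> ('d \<times> 'b) option) \<Rightarrow> 'c \<Rightarrow> 'd" where
  "index_map M D N \<phi> c = (THE d. d \<in> D \<and> \<phi> ` summand M c \<subseteq> summand N d)"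

definition sum_map :: "('c \<Rightarrow> 'd) \<Rightarrow> ('c \<times> 'a) option \<Rightarrow> ('d \<times> 'a) option" where
  "sum_map f = map_option (\<lambda>(c, a). (f c, a))"

end

theory Submission
  imports Defs
begin

text \<open>
  Every summand has, besides the unit, only the elements named \<open>Bot\<close> (below the unit) and \<open>Top\<close>
  (above it). An embedding \<open>\<phi>\<close> is injective, fixes the unit and preserves the order, so it preserves
  these names; hence it is determined by what it does to the indices
  (\<open>embedding_preserves_name\<close>). Commutation shows that indices are well behaved: two
  elements of different summands always commute, whereas \<open>Bot\<close> and \<open>Top\<close> of one summand never
  do. Therefore \<open>\<phi>\<close> can neither separate the elements of one summand nor merge two summands, so
  it is of the form \<open>\<phi>\<^sub>g\<close> for an injective map \<open>g\<close> of indices (\<open>embedding_index\<close>). Between distinct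
  summands the product is the element of smaller index, so preserving products makes \<open>g\<close> an
  order-embedding (\<open>embedding_index_order\<close>), and within one summand it makes
  \<open>M c\<close> a subalgebra of \<open>N (g c)\<close>.

  Conversely, a map \<open>\<phi>\<^sub>f\<close> preserves each clause that defines the product and the order of a
  nested sum (\<open>sum_map_embedding\<close>). Finally \<open>index_map\<close> recovers \<open>g\<close> from \<open>\<phi>\<^sub>g\<close> because each
  summand has a non-unit element, whose image lies in one summand only
  (\<open>index_map_eqI\<close>); so the two translations are mutually inverse.
\<close>

section \<open>Nested sums of monoids\<close>

lemma inj_summand_one [simp]: "inj_summand M c \<one>\<^bsub>M c\<^esub> = None"
  by (simp add: inj_summand_def)

lemma inj_summand_eq_iff [simp]: "inj_summand M c a = inj_summand M c b \<longleftrightarrow> a = b"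
  by (auto simp: inj_summand_def)

lemma nested_sum_simps [simp]:
  "mult (nested_sum C r M) = nested_mult r M"
  "one (nested_sum C r M) = None"
  "leq (nested_sum C r M) = nested_leq C r M"
  by (simp_all add: nested_sum_def)

lemma None_in_nested_sum [simp]: "None \<in> carrier (nested_sum C r M)"
  by (simp add: nested_sum_def)

lemma Some_in_nested_sum [simp]:
  "Some (c, a) \<in> carrier (nested_sum C r M) \<longleftrightarrow> c \<in> C \<and> a \<in> carrier (M c) - {\<one>\<^bsub>M c\<^esub>}"
  by (auto simp: nested_sum_def summand_def inj_summand_def split: if_splits)

lemma inj_summand_in_nested_sum:
  assumes "c \<in> C" "a \<in> carrier (M c)"
  shows "inj_summand M c a \<in> carrier (nested_sum C r M)"
  using assms by (auto simp: nested_sum_def summand_def)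

lemma nested_mult_None_right [simp]: "nested_mult r M x None = x"
  by (cases x) auto

lemma nested_mult_inj_summand:
  assumes "monoid (M c)" "a \<in> carrier (M c)" "b \<in> carrier (M c)"
  shows "nested_mult r M (inj_summand M c a) (inj_summand M c b) = inj_summand M c (a \<otimes>\<^bsub>M c\<^esub> b)"
proof -
  interpret monoid "M c" by fact
  show ?thesis
    using assms(2,3) by (simp add: inj_summand_def)
qed

lemma nested_mult_commute:
  assumes "linear_order_on C r" "c \<in> C" "d \<in> C" "c \<noteq> d"
  shows "nested_mult r M (Some (c, a)) (Some (d, b)) = nested_mult r M (Some (d, b)) (Some (c, a))"
  using assms by (auto simp: order_on_defs total_on_def dest: antisymD)

text \<open>Comparing with the unit involves one summand only: in the rules relating different summands,
  the element of smaller index is already on the correct side of the unit.\<close>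

lemma nested_leq_None_iff:
  assumes "monoid (M c)" "c \<in> C" "a \<in> carrier (M c) - {\<one>\<^bsub>M c\<^esub>}"
  shows "nested_leq C r M (Some (c, a)) None \<longleftrightarrow> a \<preceq>\<^bsub>M c\<^esub> \<one>\<^bsub>M c\<^esub>"
proof
  assume "nested_leq C r M (Some (c, a)) None"
  then show "a \<preceq>\<^bsub>M c\<^esub> \<one>\<^bsub>M c\<^esub>"
    by cases (auto simp: inj_summand_def split: if_splits)
next
  assume "a \<preceq>\<^bsub>M c\<^esub> \<one>\<^bsub>M c\<^esub>"
  then show "nested_leq C r M (Some (c, a)) None"
    using nested_leq.same[of c C a M "\<one>\<^bsub>M c\<^esub>" r] assms
    by (auto simp: inj_summand_def monoid.one_closed)
qed

lemma None_nested_leq_iff: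
  assumes "monoid (M c)" "c \<in> C" "a \<in> carrier (M c) - {\<one>\<^bsub>M c\<^esub>}"
  shows "nested_leq C r M None (Some (c, a)) \<longleftrightarrow> \<one>\<^bsub>M c\<^esub> \<preceq>\<^bsub>M c\<^esub> a"
proof
  assume "nested_leq C r M None (Some (c, a))"
  then show "\<one>\<^bsub>M c\<^esub> \<preceq>\<^bsub>M c\<^esub> a"
    by cases (auto simp: inj_summand_def split: if_splits)
next
  assume "\<one>\<^bsub>M c\<^esub> \<preceq>\<^bsub>M c\<^esub> a"
  then show "nested_leq C r M None (Some (c, a))"
    using nested_leq.same[of c C "\<one>\<^bsub>M c\<^esub>" M a r] assms
    by (auto simp: inj_summand_def monoid.one_closed)
qed

section \<open>From maps of chains to maps of sums\<close>

lemma sum_map_simps [simp]: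
  "sum_map f None = None"
  "sum_map f (Some (c, a)) = Some (f c, a)"
  by (simp_all add: sum_map_def)

lemma sum_map_inj_summand:
  assumes "\<one>\<^bsub>M c\<^esub> = \<one>\<^bsub>N (f c)\<^esub>"
  shows "sum_map f (inj_summand M c a) = inj_summand N (f c) a"
  using assms by (simp add: inj_summand_def)

lemma order_embedding_inj_on:
  assumes "antisym r" "refl_on D s" "order_embedding C r D s f"
  shows "inj_on f C"
proof (rule inj_onI)
  fix c d assume "c \<in> C" "d \<in> C" "f c = f d"
  then have "(f c, f d) \<in> s" "(f d, f c) \<in> s"
    using assms(2,3) by (auto simp: order_embedding_def refl_on_def)
  with \<open>c \<in> C\<close> \<open>d \<in> C\<close> show "c = d"
    using assms(1,3) by (auto simp: order_embedding_def dest: antisymD)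
qed

text \<open>As \<open>f\<close> is injective and preserves and reflects the order of the indices, every clause
  in the definition of the product and of the order of the first sum is carried to the same clause for the second.\<close>

proposition sum_map_embedding:
  assumes r: "antisym r" and s: "refl_on D s" and f: "order_embedding C r D s f"
    and sub: "\<And>c. c \<in> C \<Longrightarrow> is_subalgebra_of (M c) (N (f c))"
    and mon: "\<And>c. c \<in> C \<Longrightarrow> monoid (M c)"
  shows "lmonoid_embedding (nested_sum C r M) (nested_sum D s N) (sum_map f)"
proof -
  have inj: "inj_on f C"
    using order_embedding_inj_on[OF r s f] .
  have fD: "f c \<in> D" if "c \<in> C" for c
    using f that by (auto simp: order_embedding_def)
  have fr: "(f c, f d) \<in> s \<longleftrightarrow> (c, d) \<in> r" if "c \<in> C" "d \<in> C" for c d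
    using f that by (auto simp: order_embedding_def)
  have one: "\<one>\<^bsub>M c\<^esub> = \<one>\<^bsub>N (f c)\<^esub>" if "c \<in> C" for c
    using sub[OF that] by (simp add: is_subalgebra_of_def)
  have one_closed: "\<one>\<^bsub>M c\<^esub> \<in> carrier (M c)" if "c \<in> C" for c
    using mon[OF that] by (rule monoid.one_closed)
  have carr: "a \<in> carrier (N (f c))" if "c \<in> C" "a \<in> carrier (M c)" for c a
    using submonoid.subset[of "carrier (M c)" "N (f c)"] sub[OF that(1)] that(2)
    by (auto simp: is_subalgebra_of_def)
  have mult: "a \<otimes>\<^bsub>M c\<^esub> b = a \<otimes>\<^bsub>N (f c)\<^esub> b"
    and leq: "a \<preceq>\<^bsub>M c\<^esub> b \<longleftrightarrow> a \<preceq>\<^bsub>N (f c)\<^esub> b"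
    if "c \<in> C" "a \<in> carrier (M c)" "b \<in> carrier (M c)" for c a b
    using sub[OF that(1)] that(2,3) by (auto simp: is_subalgebra_of_def)
  have clos: "sum_map f x \<in> carrier (nested_sum D s N)" if "x \<in> carrier (nested_sum C r M)" for x
    using that fD carr one by (cases x) auto
  have hom: "sum_map f (nested_mult r M x y) = nested_mult s N (sum_map f x) (sum_map f y)"
    if x: "x \<in> carrier (nested_sum C r M)" and y: "y \<in> carrier (nested_sum C r M)" for x y
  proof (cases "x = None \<or> y = None")
    case True
    then show ?thesis by auto
  next
    case False
    then obtain c a d b where [simp]: "x = Some (c, a)" "y = Some (d, b)"
      by auto
    have cd: "c \<in> C" "d \<in> C" and ab: "a \<in> carrier (M c)" "b \<in> carrier (M d)"
      using x y by auto
    show ?thesis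
    proof (cases "c = d")
      case True
      then show ?thesis
        using cd ab mult one by (simp add: sum_map_inj_summand)
    next
      case False
      then have "f c \<noteq> f d"
        using inj cd by (auto dest: inj_onD)
      then show ?thesis
        using False fr cd by simp
    qed
  qed
  have inj': "inj_on (sum_map f) (carrier (nested_sum C r M))"
  proof (rule inj_onI)
    fix x y assume "x \<in> carrier (nested_sum C r M)" "y \<in> carrier (nested_sum C r M)"
      "sum_map f x = sum_map f y"
    then show "x = y"
      using inj by (cases x; cases y) (auto dest: inj_onD)
  qed
  have mono: "nested_leq D s N (sum_map f x) (sum_map f y)" if "nested_leq C r M x y" for x y
    using that
  proof induction
    case unit
    show ?case by (simp add: nested_leq.unit)
  next
    case (same c a b)
    then show ?case
      using nested_leq.same[of "f c" D a N b s] fD carr leq one by (simp add: sum_map_inj_summand)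
  next
    case (below c d a b)
    have "f c \<noteq> f d"
      using inj below by (auto dest: inj_onD)
    moreover have "a \<preceq>\<^bsub>N (f c)\<^esub> \<one>\<^bsub>N (f c)\<^esub>"
      using leq[of c a "\<one>\<^bsub>M c\<^esub>"] below one[of c] one_closed[of c] by auto
    ultimately show ?case
      using nested_leq.below[of "f c" D "f d" s a N b] below fD carr fr one
      by (simp add: sum_map_inj_summand)
  next
    case (above c d a b)
    have "f c \<noteq> f d"
      using inj above by (auto dest: inj_onD)
    moreover have "\<one>\<^bsub>N (f c)\<^esub> \<preceq>\<^bsub>N (f c)\<^esub> a"
      using leq[of c "\<one>\<^bsub>M c\<^esub>" a] above one[of c] one_closed[of c] by auto
    ultimately show ?case
      using nested_leq.above[of "f c" D "f d" s a N b] above fD carr fr one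
      by (simp add: sum_map_inj_summand)
  qed
  show ?thesis
    using clos hom inj' mono by (auto simp: lmonoid_embedding_def hom_def)
qed

text \<open>Two summands meet in the unit only, so the image of one non-unit element already determines
  the summand that contains the image of \<open>M c\<close>.\<close>

lemma index_map_eqI:
  assumes "d \<in> D" "a \<in> carrier (M c)" "a \<noteq> \<one>\<^bsub>N d\<^esub>"
    and "\<And>a. a \<in> carrier (M c) \<Longrightarrow> a \<in> carrier (N d)"
    and "\<And>a. a \<in> carrier (M c) \<Longrightarrow> \<phi> (inj_summand M c a) = inj_summand N d a"
  shows "index_map M D N \<phi> c = d"
  unfolding index_map_def
proof (rule the_equality)
  show "d \<in> D \<and> \<phi> ` summand M c \<subseteq> summand N d"
    using assms by (auto simp: summand_def)
next
  fix d' assume d': "d' \<in> D \<and> \<phi> ` summand M c \<subseteq> summand N d'"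
  then have "inj_summand N d a \<in> summand N d'"
    using assms(2,5) by (force simp: summand_def)
  then show "d' = d"
    using assms(3) by (auto simp: summand_def inj_summand_def split: if_splits)
qed

section \<open>The four algebras\<close>

lemma four_monoid:
  assumes "A \<in> {C2, C2_dual, G3, D3}"
  shows "monoid A"
proof -
  interpret idempotent_ordered_monoid A
    using assms by (rule idempotent_ordered_monoid_four)
  show ?thesis by unfold_locales
qed

lemma four_one:
  assumes "A \<in> {C2, C2_dual, G3, D3}"
  shows "\<one>\<^bsub>A\<^esub> = Unit"
  using assms by (auto simp: C2_def C2_dual_def G3_def D3_def)

lemma four_leq_iff:
  assumes "A \<in> {C2, C2_dual, G3, D3}"
  shows "a \<preceq>\<^bsub>A\<^esub> b \<longleftrightarrow> a = b \<or> a = Bot \<or> b = Top"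
  using assms by (auto simp: C2_def C2_dual_def G3_def D3_def)

lemma four_nontrivial:
  assumes "A \<in> {C2, C2_dual, G3, D3}"
  obtains a where "a \<in> carrier A" "a \<noteq> Unit"
proof -
  have "Bot \<in> carrier A \<or> Top \<in> carrier A"
    using assms by (auto simp: C2_def C2_dual_def G3_def D3_def)
  then show thesis
    using that by blast
qed

text \<open>The non-unit elements form a left-zero band in \<open>G3\<close> and a right-zero band in \<open>D3\<close>; in the
  two-element algebras there is only one of them.\<close>

lemma four_noncommuting:
  assumes "A \<in> {C2, C2_dual, G3, D3}" "a \<in> carrier A" "b \<in> carrier A"
    "a \<noteq> Unit" "b \<noteq> Unit" "a \<noteq> b"
  shows "a \<otimes>\<^bsub>A\<^esub> b \<noteq> b \<otimes>\<^bsub>A\<^esub> a"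
  using assms by (auto simp: C2_def C2_dual_def G3_def D3_def)

text \<open>The unit and the order depend on the names only, so they agree in any two of the algebras.\<close>

lemma four_subalgebraI:
  assumes A: "A \<in> {C2, C2_dual, G3, D3}" and B: "B \<in> {C2, C2_dual, G3, D3}"
    and carr: "carrier A \<subseteq> carrier B"
    and mult: "\<And>a b. a \<in> carrier A \<Longrightarrow> b \<in> carrier A \<Longrightarrow> a \<otimes>\<^bsub>A\<^esub> b = a \<otimes>\<^bsub>B\<^esub> b"
  shows "is_subalgebra_of A B"
proof -
  interpret A: monoid A using A by (rule four_monoid)
  have "submonoid (carrier A) B"
  proof
    show "\<one>\<^bsub>B\<^esub> \<in> carrier A"
      using A.one_closed four_one[OF A] four_one[OF B] by simp
  qed (use carr A.m_closed mult in auto)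
  then show ?thesis
    using mult four_one[OF A] four_one[OF B] four_leq_iff[OF A] four_leq_iff[OF B]
    by (simp add: is_subalgebra_of_def)
qed

section \<open>From embeddings of sums to maps of chains\<close>

locale four_sums_embedding =
  fixes C :: "'c set" and r :: "'c rel" and D :: "'d set" and s :: "'d rel"
    and M :: "'c \<Rightarrow> elt ordered_monoid" and N :: "'d \<Rightarrow> elt ordered_monoid"
    and \<phi> :: "('c \<times> elt) option \<Rightarrow> ('d \<times> elt) option"
  assumes r: "linear_order_on C r" and s: "linear_order_on D s"
    and M: "c \<in> C \<Longrightarrow> M c \<in> {C2, C2_dual, G3, D3}"
    and N: "d \<in> D \<Longrightarrow> N d \<in> {C2, C2_dual, G3, D3}"
    and emb: "lmonoid_embedding (nested_sum C r M) (nested_sum D s N) \<phi>"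
begin

lemma map_None: "\<phi> None = None"
  using emb by (simp add: lmonoid_embedding_def)

lemma map_closed: "x \<in> carrier (nested_sum C r M) \<Longrightarrow> \<phi> x \<in> carrier (nested_sum D s N)"
  using emb by (auto simp: lmonoid_embedding_def hom_def)

lemma map_mult:
  assumes "x \<in> carrier (nested_sum C r M)" "y \<in> carrier (nested_sum C r M)"
  shows "\<phi> (nested_mult r M x y) = nested_mult s N (\<phi> x) (\<phi> y)"
  using emb assms by (auto simp: lmonoid_embedding_def hom_def)

lemma map_inj:
  assumes "x \<in> carrier (nested_sum C r M)" "y \<in> carrier (nested_sum C r M)" "\<phi> x = \<phi> y"
  shows "x = y"
  using emb assms by (auto simp: lmonoid_embedding_def dest: inj_onD)

lemma map_mono:
  assumes "x \<in> carrier (nested_sum C r M)" "y \<in> carrier (nested_sum C r M)" "nested_leq C r M x y"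
  shows "nested_leq D s N (\<phi> x) (\<phi> y)"
  using emb assms by (auto simp: lmonoid_embedding_def)

text \<open>The name of a non-unit element records the side of the unit on which it lies.\<close>

lemma embedding_preserves_name:
  assumes c: "c \<in> C" and a: "a \<in> carrier (M c)" "a \<noteq> Unit"
  obtains d where "d \<in> D" "a \<in> carrier (N d)" "\<phi> (Some (c, a)) = Some (d, a)"
proof -
  note Mc = M[OF c]
  have x: "Some (c, a) \<in> carrier (nested_sum C r M)"
    using c a four_one[OF Mc] by simp
  have "\<phi> (Some (c, a)) \<noteq> None"
    using map_inj[OF x None_in_nested_sum] map_None by (metis option.distinct(1))
  then obtain d b where db: "\<phi> (Some (c, a)) = Some (d, b)"
    by (cases "\<phi> (Some (c, a))") auto
  then have y: "d \<in> D" "b \<in> carrier (N d) - {\<one>\<^bsub>N d\<^esub>}"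
    using map_closed[OF x] by auto
  note Nd = N[OF y(1)]
  have "b = a"
  proof (cases a)
    case Bot
    then have "nested_leq C r M (Some (c, a)) None"
      using nested_leq_None_iff[of M c C a r, OF four_monoid[OF Mc] c] a four_one[OF Mc]
        four_leq_iff[OF Mc] by simp
    then have "b \<preceq>\<^bsub>N d\<^esub> \<one>\<^bsub>N d\<^esub>"
      using map_mono[OF x None_in_nested_sum] db map_None
        nested_leq_None_iff[of N d D b s, OF four_monoid[OF Nd] y] by simp
    then show ?thesis
      using Bot y four_one[OF Nd] four_leq_iff[OF Nd] by auto
  next
    case Top
    then have "nested_leq C r M None (Some (c, a))"
      using None_nested_leq_iff[of M c C a r, OF four_monoid[OF Mc] c] a four_one[OF Mc]
        four_leq_iff[OF Mc] by simp
    then have "\<one>\<^bsub>N d\<^esub> \<preceq>\<^bsub>N d\<^esub> b"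
      using map_mono[OF None_in_nested_sum x] db map_None
        None_nested_leq_iff[of N d D b s, OF four_monoid[OF Nd] y] by simp
    then show ?thesis
      using Top y four_one[OF Nd] four_leq_iff[OF Nd] by auto
  qed (use a in simp)
  with that y db show thesis by auto
qed

text \<open>If \<open>\<phi>\<close> sent \<open>Bot\<close> and \<open>Top\<close> of one summand to different summands, their images would commute,
  although the elements themselves do not.\<close>

lemma embedding_index:
  "\<exists>g. \<forall>c\<in>C. g c \<in> D \<and> (\<forall>a\<in>carrier (M c). a \<in> carrier (N (g c)) \<and>
    \<phi> (inj_summand M c a) = inj_summand N (g c) a)"
proof -
  have "\<exists>d\<in>D. \<forall>a\<in>carrier (M c). a \<in> carrier (N d) \<and> \<phi> (inj_summand M c a) = inj_summand N d a"
    if c: "c \<in> C" for c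
  proof -
    note Mc = M[OF c]
    obtain a where a: "a \<in> carrier (M c)" "a \<noteq> Unit"
      using four_nontrivial[OF Mc] .
    obtain d where d: "d \<in> D" "a \<in> carrier (N d)" "\<phi> (Some (c, a)) = Some (d, a)"
      using embedding_preserves_name[OF c a] .
    have "b \<in> carrier (N d) \<and> \<phi> (inj_summand M c b) = inj_summand N d b"
      if b: "b \<in> carrier (M c)" for b
    proof (cases "b = Unit")
      case True
      then show ?thesis
        using map_None monoid.one_closed[OF four_monoid[OF N[OF d(1)]]]
          four_one[OF Mc] four_one[OF N[OF d(1)]] by (simp add: inj_summand_def)
    next
      case False
      obtain e where e: "e \<in> D" "b \<in> carrier (N e)" "\<phi> (Some (c, b)) = Some (e, b)"
        using embedding_preserves_name[OF c b False] .
      have x: "Some (c, a) \<in> carrier (nested_sum C r M)" "Some (c, b) \<in> carrier (nested_sum C r M)"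
        using c a b False four_one[OF Mc] by auto
      have "e = d"
      proof (rule ccontr)
        assume "e \<noteq> d"
        with d(3) e(3) have "a \<noteq> b"
          by auto
        have "\<phi> (nested_mult r M (Some (c, a)) (Some (c, b)))
            = \<phi> (nested_mult r M (Some (c, b)) (Some (c, a)))"
          using nested_mult_commute[OF s e(1) d(1) \<open>e \<noteq> d\<close>, where a = b and b = a and M = N]
          by (simp only: map_mult[OF x] map_mult[OF x(2,1)] d(3) e(3))
        moreover have "nested_mult r M (Some (c, a)) (Some (c, b)) \<in> carrier (nested_sum C r M)"
          "nested_mult r M (Some (c, b)) (Some (c, a)) \<in> carrier (nested_sum C r M)"
          using a b c monoid.m_closed[OF four_monoid[OF Mc]]
          by (simp_all add: inj_summand_in_nested_sum)
        ultimately have "nested_mult r M (Some (c, a)) (Some (c, b))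
            = nested_mult r M (Some (c, b)) (Some (c, a))"
          using map_inj by blast
        then have "a \<otimes>\<^bsub>M c\<^esub> b = b \<otimes>\<^bsub>M c\<^esub> a"
          by simp
        then show False
          using four_noncommuting[OF Mc a(1) b a(2) False \<open>a \<noteq> b\<close>] by simp
      qed
      then show ?thesis
        using e False four_one[OF Mc] four_one[OF N[OF e(1)]] by (simp add: inj_summand_def)
    qed
    with d(1) show ?thesis by blast
  qed
  then show ?thesis
    by metis
qed

context
  fixes g
  assumes gD: "\<And>c. c \<in> C \<Longrightarrow> g c \<in> D"
    and g_carrier: "\<And>c a. c \<in> C \<Longrightarrow> a \<in> carrier (M c) \<Longrightarrow> a \<in> carrier (N (g c))"
    and map_inj_summand:
      "\<And>c a. c \<in> C \<Longrightarrow> a \<in> carrier (M c) \<Longrightarrow> \<phi> (inj_summand M c a) = inj_summand N (g c) a"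
begin

lemma map_Some:
  assumes "c \<in> C" "a \<in> carrier (M c)" "a \<noteq> Unit"
  shows "\<phi> (Some (c, a)) = Some (g c, a)"
  using map_inj_summand[OF assms(1,2)] assms(3) four_one[OF M[OF assms(1)]]
    four_one[OF N[OF gD[OF assms(1)]]] by (simp add: inj_summand_def)

text \<open>Elements \<open>x\<close>, \<open>y\<close> of distinct summands \<open>c\<close>, \<open>c'\<close> with \<open>c\<close> smaller satisfy
  \<open>x y = y x = x\<close>. The images therefore commute, so they lie in distinct summands, and their product
  shows which index is smaller.\<close>

lemma index_strict_mono:
  assumes c: "c \<in> C" "c' \<in> C" "(c, c') \<in> r" "c \<noteq> c'"
  shows "g c \<noteq> g c' \<and> (g c, g c') \<in> s"
proof -
  note Mc = M[OF c(1)] and Mc' = M[OF c(2)]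
  obtain a where a: "a \<in> carrier (M c)" "a \<noteq> Unit"
    using four_nontrivial[OF Mc] .
  obtain b where b: "b \<in> carrier (M c')" "b \<noteq> Unit"
    using four_nontrivial[OF Mc'] .
  have x: "Some (c, a) \<in> carrier (nested_sum C r M)" "Some (c', b) \<in> carrier (nested_sum C r M)"
    using c a b four_one[OF Mc] four_one[OF Mc'] by auto
  have "(c', c) \<notin> r"
    using r c by (auto simp: order_on_defs dest: antisymD)
  then have prod: "nested_mult s N (Some (g c, a)) (Some (g c', b)) = Some (g c, a)"
      "nested_mult s N (Some (g c', b)) (Some (g c, a)) = Some (g c, a)"
    using map_mult[OF x] map_mult[OF x(2,1)] map_Some[OF c(1) a] map_Some[OF c(2) b] c
    by simp_all
  have ne: "g c \<noteq> g c'"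
  proof
    assume eq: "g c = g c'"
    have "a \<noteq> b"
      using map_inj[OF x] map_Some[OF c(1) a] map_Some[OF c(2) b] eq c(4) by auto
    moreover have "a \<otimes>\<^bsub>N (g c)\<^esub> b = b \<otimes>\<^bsub>N (g c)\<^esub> a"
      using prod eq inj_summand_eq_iff[of N "g c" "a \<otimes>\<^bsub>N (g c)\<^esub> b" "b \<otimes>\<^bsub>N (g c)\<^esub> a"] by simp
    ultimately show False
      using four_noncommuting[OF N[OF gD[OF c(1)]] g_carrier[OF c(1) a(1)], of b]
        g_carrier[OF c(2) b(1)] a b eq by auto
  qed
  with prod(1) show ?thesis
    by (auto split: if_splits)
qed

lemma embedding_index_order: "order_embedding C r D s g"
  unfolding order_embedding_def
proof (intro conjI ballI iffI)
  show "g ` C \<subseteq> D"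
    using gD by auto
next
  fix c c' assume c: "c \<in> C" "c' \<in> C"
  have refl: "(c, c) \<in> r" "(g c, g c) \<in> s"
    using r s c gD by (auto simp: order_on_defs refl_on_def)
  show "(g c, g c') \<in> s" if "(c, c') \<in> r"
    using that index_strict_mono[OF c] refl by (cases "c = c'") auto
  show "(c, c') \<in> r" if "(g c, g c') \<in> s"
  proof (rule ccontr)
    assume "(c, c') \<notin> r"
    with refl have "c \<noteq> c'" "(c', c) \<in> r"
      using r c by (auto simp: order_on_defs total_on_def)
    with index_strict_mono[OF c(2,1)] have "g c \<noteq> g c'" "(g c', g c) \<in> s"
      by auto
    with that show False
      using s by (auto simp: order_on_defs dest: antisymD)
  qed
qed

lemma embedding_index_subalgebra:
  assumes c: "c \<in> C"
  shows "is_subalgebra_of (M c) (N (g c))"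
proof (rule four_subalgebraI[OF M[OF c] N[OF gD[OF c]]])
  show "carrier (M c) \<subseteq> carrier (N (g c))"
    using g_carrier[OF c] by blast
next
  note Mc = four_monoid[OF M[OF c]] and Nc = four_monoid[OF N[OF gD[OF c]]]
  fix a b assume ab: "a \<in> carrier (M c)" "b \<in> carrier (M c)"
  have "inj_summand N (g c) (a \<otimes>\<^bsub>M c\<^esub> b) = \<phi> (inj_summand M c (a \<otimes>\<^bsub>M c\<^esub> b))"
    using map_inj_summand[OF c monoid.m_closed[OF Mc ab]] by simp
  also have "\<dots> = nested_mult s N (inj_summand N (g c) a) (inj_summand N (g c) b)"
    using map_mult[of "inj_summand M c a" "inj_summand M c b"]
      inj_summand_in_nested_sum[of c C _ M r] c
      nested_mult_inj_summand[of M c a b r, OF Mc ab] map_inj_summand[OF c] ab by simp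
  also have "\<dots> = inj_summand N (g c) (a \<otimes>\<^bsub>N (g c)\<^esub> b)"
    using nested_mult_inj_summand[of N "g c" a b s, OF Nc g_carrier[OF c ab(1)] g_carrier[OF c ab(2)]] .
  finally show "a \<otimes>\<^bsub>M c\<^esub> b = a \<otimes>\<^bsub>N (g c)\<^esub> b"
    by simp
qed

lemma index_map_embedding:
  assumes c: "c \<in> C"
  shows "index_map M D N \<phi> c = g c"
proof -
  obtain a where "a \<in> carrier (M c)" "a \<noteq> Unit"
    using four_nontrivial[OF M[OF c]] .
  then show ?thesis
    using index_map_eqI[of "g c" D a M c N \<phi>] gD[OF c] g_carrier[OF c] map_inj_summand[OF c]
      four_one[OF N[OF gD[OF c]]] by simp
qed

lemma sum_map_index_map:
  assumes "x \<in> carrier (nested_sum C r M)"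
  shows "sum_map (index_map M D N \<phi>) x = \<phi> x"
proof (cases x)
  case None
  then show ?thesis using map_None by simp
next
  case (Some p)
  then obtain c a where [simp]: "x = Some (c, a)"
    by (cases p) auto
  with assms have c: "c \<in> C" and "a \<in> carrier (M c)" "a \<noteq> Unit"
    using four_one[OF M] by auto
  then show ?thesis
    using map_Some index_map_embedding by simp
qed

end

end

section \<open>The correspondence\<close>

theorem lemma3p17:
  fixes C :: "'c set" and r :: "'c rel" and D :: "'d set" and s :: "'d rel"
    and M :: "'c \<Rightarrow> elt ordered_monoid" and N :: "'d \<Rightarrow> elt ordered_monoid"
    and \<phi> :: "('c \<times> elt) option \<Rightarrow> ('d \<times> elt) option" and f :: "'c \<Rightarrow> 'd"
  assumes "linear_order_on C r" and "linear_order_on D s"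
    and "\<forall>c\<in>C. M c \<in> {C2, C2_dual, G3, D3}" and "\<forall>d\<in>D. N d \<in> {C2, C2_dual, G3, D3}"
    and "lmonoid_embedding (nested_sum C r M) (nested_sum D s N) \<phi>"
    and "order_embedding C r D s f" and "\<forall>c\<in>C. is_subalgebra_of (M c) (N (f c))"
  shows
    "(order_embedding C r D s (index_map M D N \<phi>) \<and>
      (\<forall>c\<in>C. is_subalgebra_of (M c) (N (index_map M D N \<phi> c)))) \<and>
     lmonoid_embedding (nested_sum C r M) (nested_sum D s N) (sum_map f) \<and>
     (\<forall>x\<in>carrier (nested_sum C r M). sum_map (index_map M D N \<phi>) x = \<phi> x) \<and>
     (\<forall>c\<in>C. index_map M D N (sum_map f) c = f c)"
proof -
  interpret four_sums_embedding C r D s M N \<phi>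
    using assms by unfold_locales auto
  have ord: "antisym r" "refl_on D s"
    using r s by (auto simp: order_on_defs)
  obtain g where "\<forall>c\<in>C. g c \<in> D \<and> (\<forall>a\<in>carrier (M c). a \<in> carrier (N (g c)) \<and>
      \<phi> (inj_summand M c a) = inj_summand N (g c) a)"
    using embedding_index by blast
  then have g: "\<And>c. c \<in> C \<Longrightarrow> g c \<in> D"
    "\<And>c a. c \<in> C \<Longrightarrow> a \<in> carrier (M c) \<Longrightarrow> a \<in> carrier (N (g c))"
    "\<And>c a. c \<in> C \<Longrightarrow> a \<in> carrier (M c) \<Longrightarrow> \<phi> (inj_summand M c a) = inj_summand N (g c) a"
    by simp_all
  have idx: "index_map M D N \<phi> c = g c" if "c \<in> C" for c
    using index_map_embedding[OF g that] .
  have "order_embedding C r D s (index_map M D N \<phi>)"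
    using embedding_index_order[OF g] idx by (auto simp: order_embedding_def)
  moreover have "\<forall>c\<in>C. is_subalgebra_of (M c) (N (index_map M D N \<phi> c))"
    using embedding_index_subalgebra[OF g] idx by simp
  moreover have "lmonoid_embedding (nested_sum C r M) (nested_sum D s N) (sum_map f)"
    using sum_map_embedding[OF ord assms(6)] assms(7) M four_monoid by blast
  moreover have "\<forall>x\<in>carrier (nested_sum C r M). sum_map (index_map M D N \<phi>) x = \<phi> x"
    using sum_map_index_map[OF g] by blast
  moreover have "index_map M D N (sum_map f) c = f c" if c: "c \<in> C" for c
  proof -
    obtain a where a: "a \<in> carrier (M c)" "a \<noteq> Unit"
      using four_nontrivial[OF M[OF c]] .
    have fc: "f c \<in> D"
      using assms(6) c by (auto simp: order_embedding_def)
    have "is_subalgebra_of (M c) (N (f c))"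
      using assms(7) c by blast
    then have "\<one>\<^bsub>M c\<^esub> = \<one>\<^bsub>N (f c)\<^esub>" "carrier (M c) \<subseteq> carrier (N (f c))"
      by (simp_all add: is_subalgebra_of_def submonoid.subset)
    then show ?thesis
      using index_map_eqI[of "f c" D a M c N "sum_map f"] fc a four_one[OF N[OF fc]]
        sum_map_inj_summand[of M c N f] by auto
  qed
  ultimately show ?thesis
    by (intro conjI ballI) auto
qed

end
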